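(* Let $R$ be a local domain whose Jacobson radical satisfies $J(R)=gR$ for some $g\in R$ and $\bigcap_n (J(R))^n=0$. Let $S=M_2(R)$ be the ring of $2\times 2$ matrices over $R$. Then each matrix $A\in S$ with $l.ann(A)\neq 0$ is a product of idempotent matrices (in $S$).
   Context: All rings are nonzero, associative, with identity $1$, and need not be commutative. A ring is local if it has a unique maximal right ideal (equivalently, a unique maximal left ideal). A domain is a (not necessarily commutative) nonzero ring without zero divisors. For $A\in S$, $l.ann(A)=\{X\in S: XA=0\}$ is the left annihilator of $A$ in $S$. *)

theory Defs
  imports "HOL-Analysis.Analysis"
begin

definition right_ideal :: "'a::ring_1 set \<Rightarrow> bool" where
  "right_ideal I \<longleftrightarrow>
     0 \<in> I \<and> (\<forall>x\<in>I. \<forall>y\<in>I. x + y \<in> I) \<and> (\<forall>x\<in>I. - x \<in> I) \<and> (\<forall>x\<in>I. \<forall>r. x * r \<in> I)"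

definition maximal_right_ideal :: "'a::ring_1 set \<Rightarrow> bool" where
  "maximal_right_ideal M \<longleftrightarrow>
     right_ideal M \<and> M \<noteq> UNIV \<and>
     (\<forall>I. right_ideal I \<longrightarrow> M \<subseteq> I \<longrightarrow> I = M \<or> I = UNIV)"

definition local_ring :: "'a::ring_1 itself \<Rightarrow> bool" where
  "local_ring _ \<longleftrightarrow> (\<exists>!M::'a set. maximal_right_ideal M)"

definition jacobson_radical :: "'a::ring_1 set" where
  "jacobson_radical = \<Inter>{M. maximal_right_ideal M}"

definition principal_right_ideal :: "'a::ring_1 \<Rightarrow> 'a set" where
  "principal_right_ideal g = {g * r | r. True}"

text \<open>Ideal products consist of all finite sums of elementwise products; the zeroth power of an
  ideal is the whole ring.\<close>

definition ideal_prod :: "'a::ring_1 set \<Rightarrow> 'a set \<Rightarrow> 'a set" where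
  "ideal_prod I J =
     {(\<Sum>k<m. a k * b k) | (m::nat) a b. (\<forall>k<m. a k \<in> I) \<and> (\<forall>k<m. b k \<in> J)}"

primrec ideal_power :: "'a::ring_1 set \<Rightarrow> nat \<Rightarrow> 'a set" where
  "ideal_power I 0 = UNIV"
| "ideal_power I (Suc n) = ideal_prod (ideal_power I n) I"

text \<open>Square matrices are multiplied with \<open>**\<close> and have identity \<open>mat 1\<close>; the operation \<open>*\<close> on
  vector types is componentwise and is not used.\<close>

definition left_ann :: "'a::ring_1 ^ 'n ^ 'n \<Rightarrow> ('a ^ 'n ^ 'n) set" where
  "left_ann A = {X. X ** A = 0}"

definition idempotent_matrix :: "'a::ring_1 ^ 'n ^ 'n \<Rightarrow> bool" where
  "idempotent_matrix E \<longleftrightarrow> E ** E = E"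

definition product_of_idempotents :: "'a::ring_1 ^ 'n ^ 'n \<Rightarrow> bool" where
  "product_of_idempotents A \<longleftrightarrow>
     (\<exists>Es. Es \<noteq> [] \<and> (\<forall>E\<in>set Es. idempotent_matrix E) \<and> A = foldr (**) Es (mat 1))"

end

theory Submission
  imports Defs
begin

text \<open>A matrix of the form \<open>p a q\<close>, with a column \<open>p\<close> and a row \<open>q\<close> each having an entry \<open>1\<close>
  and an arbitrary scalar \<open>a\<close> between them, is a product of idempotents over any ring, as soon as
  the size is at least two. Indeed \<open>p q\<close> is idempotent whenever \<open>q p = 1\<close>, and in a product
  \<open>(p\<^sub>1 q\<^sub>1) (p\<^sub>2 q\<^sub>2) (p\<^sub>3 q\<^sub>3)\<close> only the scalars \<open>q\<^sub>1 p\<^sub>2\<close> and \<open>q\<^sub>2 p\<^sub>3\<close> remain between the outer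
  column and row; these scalars can be made \<open>a\<close> and \<open>1\<close> (\<open>product_of_idempotents_outer\<close>).

  It remains to bring \<open>A\<close> into this form. An element outside the maximal right ideal \<open>g R\<close> is a
  unit, and no nonzero element lies in every \<open>g\<^sup>n R\<close>, so every nonzero element is \<open>g\<^sup>n u\<close> with \<open>u\<close>
  a unit. Hence of two elements one is always a right multiple of the other
  (\<open>right_chain_local_domain\<close>), and every row of length two is \<open>a q\<close> with an entry \<open>1\<close> in \<open>q\<close>.
  Apply this twice. A nonzero row \<open>v = x w\<close> with \<open>v A = 0\<close> and an entry \<open>1\<close> in \<open>w\<close> gives
  \<open>w A = 0\<close> by cancelling \<open>x\<close>, so one row of \<open>A\<close> is a left multiple of the other one and
  \<open>A = p r\<close> with an entry \<open>1\<close> in \<open>p\<close>. Then write \<open>r = a q\<close>.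

  Only right divisibility enters: left ideals need not form a chain here, since
  \<open>R g \<subseteq> g R\<close> may be a strict inclusion.\<close>

section \<open>Products of idempotents of rank one\<close>

definition outer :: "'a::semiring_1 ^ 'n \<Rightarrow> 'a ^ 'n \<Rightarrow> 'a ^ 'n ^ 'n" where
  "outer p q = (\<chi> i j. p $ i * q $ j)"

lemma outer_mult_outer:
  "outer p q ** outer r s = outer p (\<chi> j. (\<Sum>k\<in>UNIV. q $ k * r $ k) * s $ j)"
  by (simp add: outer_def matrix_matrix_mult_def vec_eq_iff sum_distrib_left sum_distrib_right
      mult.assoc)

lemma idempotent_outer:
  assumes "(\<Sum>k\<in>UNIV. q $ k * p $ k) = 1"
  shows "idempotent_matrix (outer p q)"
  unfolding idempotent_matrix_def outer_mult_outer assms by (simp add: outer_def)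

lemma sum_mult_axis:
  "(\<Sum>k\<in>UNIV. q $ k * axis l (1::'a::semiring_1) $ k) = q $ l"
  by (simp add: axis_def if_distrib cong: if_cong)

text \<open>The first factor \<open>p q\<^sub>1\<close> carries the scalar: the column \<open>p\<close> only forces \<open>q\<^sub>1 p = 1\<close>, and this
  can be achieved through the entry \<open>k\<close> of \<open>q\<^sub>1\<close> while \<open>a\<close> is placed at another index \<open>k'\<close>. The
  all-ones row then connects the index \<open>k'\<close> with the index \<open>l\<close> without contributing a scalar.\<close>

lemma product_of_idempotents_outer:
  fixes p q :: "'a::ring_1 ^ 'n"
  assumes p: "p $ k = 1" and q: "q $ l = 1" and k': "k' \<noteq> k"
  shows "product_of_idempotents (outer p (\<chi> j. a * q $ j))"
proof -
  define q1 :: "'a ^ 'n" where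
    "q1 = (\<chi> i. if i = k then 1 - a * p $ k' else if i = k' then a else 0)"
  define one :: "'a ^ 'n" where "one = (\<chi> i. 1)"
  let ?Es = "[outer p q1, outer (axis k' 1) one, outer (axis l 1) q]"
  have "(\<Sum>i\<in>UNIV. q1 $ i * p $ i) = (\<Sum>i\<in>{k, k'}. q1 $ i * p $ i)"
    by (rule sum.mono_neutral_right) (auto simp: q1_def)
  also have "\<dots> = 1"
    using k' by (simp add: q1_def p)
  finally have "idempotent_matrix (outer p q1)"
    by (rule idempotent_outer)
  moreover have "idempotent_matrix (outer (axis k' 1) one)"
    by (rule idempotent_outer) (simp only: sum_mult_axis, simp add: one_def)
  moreover have "idempotent_matrix (outer (axis l 1) q)"
    by (rule idempotent_outer) (simp add: sum_mult_axis q)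
  moreover have "outer p (\<chi> j. a * q $ j) = foldr (**) ?Es (mat 1)"
  proof -
    have "q1 $ k' = a" "one $ l = 1"
      using k' by (simp_all add: q1_def one_def)
    then show ?thesis
      by (simp add: outer_mult_outer sum_mult_axis)
  qed
  ultimately show ?thesis
    unfolding product_of_idempotents_def by (intro exI[of _ ?Es]) simp
qed

section \<open>Right divisibility in the local domain\<close>

lemma right_ideal_principal: "right_ideal (principal_right_ideal (g::'a::ring_1))"
  unfolding right_ideal_def principal_right_ideal_def
proof (intro conjI ballI allI)
  fix x y r assume x: "x \<in> {g * r |r. True}" and y: "y \<in> {g * r |r. True}"
  from x y show "x + y \<in> {g * r |r. True}"
    by (auto simp: distrib_left[symmetric])
next
  fix x assume "x \<in> {g * r |r. True}"
  then show "- x \<in> {g * r |r. True}"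
    by (auto simp: mult_minus_right[symmetric] simp del: mult_minus_right)
qed (auto simp: mult.assoc intro: exI[of _ 0])

lemma right_ideal_eq_UNIV_iff:
  assumes "right_ideal I"
  shows "I = UNIV \<longleftrightarrow> 1 \<in> I"
proof
  assume "1 \<in> I"
  then have "1 * r \<in> I" for r
    using assms unfolding right_ideal_def by blast
  then show "I = UNIV" by auto
qed simp

lemma right_ideal_subset_maximal:
  fixes I :: "'a::ring_1 set"
  assumes I: "right_ideal I" "I \<noteq> UNIV"
  shows "\<exists>M. maximal_right_ideal M \<and> I \<subseteq> M"
proof -
  let ?P = "{K. right_ideal K \<and> 1 \<notin> K \<and> I \<subseteq> K}"
  have "\<exists>M\<in>?P. \<forall>X\<in>?P. M \<subseteq> X \<longrightarrow> X = M"
  proof (rule subset_Zorn_nonempty)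
    show "?P \<noteq> {}"
      using I right_ideal_eq_UNIV_iff by blast
  next
    fix C assume "C \<noteq> {}" and C: "subset.chain ?P C"
    then obtain K0 where K0: "K0 \<in> C" by blast
    have sub: "right_ideal K \<and> 1 \<notin> K \<and> I \<subseteq> K" if "K \<in> C" for K
      using C that unfolding subset.chain_def by blast
    have tot: "K \<subseteq> L \<or> L \<subseteq> K" if "K \<in> C" "L \<in> C" for K L
      using C that unfolding subset.chain_def by blast
    have add: "x + y \<in> \<Union>C" if xy: "x \<in> \<Union>C" "y \<in> \<Union>C" for x y
    proof -
      obtain K L where KL: "x \<in> K" "K \<in> C" "y \<in> L" "L \<in> C"
        using xy by blast
      then obtain N where "N \<in> C" "x \<in> N" "y \<in> N"
        using tot[of K L] by blast
      moreover from this have "x + y \<in> N"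
        using sub[of N] unfolding right_ideal_def by simp
      ultimately show ?thesis by blast
    qed
    have "- x \<in> K \<and> x * r \<in> K" if "x \<in> K" "K \<in> C" for x r K
      using sub[OF that(2)] that(1) unfolding right_ideal_def by simp
    then have "- x \<in> \<Union>C \<and> x * r \<in> \<Union>C" if "x \<in> \<Union>C" for x r
      using that by blast
    moreover have "0 \<in> \<Union>C"
      using sub[OF K0] K0 unfolding right_ideal_def by blast
    ultimately have "right_ideal (\<Union>C)"
      using add unfolding right_ideal_def by simp
    then show "\<Union>C \<in> ?P"
      using sub K0 by blast
  qed
  then obtain M where "M \<in> ?P" and max: "\<forall>X\<in>?P. M \<subseteq> X \<longrightarrow> X = M"
    by (rule bexE)
  then have M: "right_ideal M" "1 \<notin> M" "I \<subseteq> M"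
    by simp_all
  have "K = M \<or> K = UNIV" if K: "right_ideal K" "M \<subseteq> K" for K
  proof (cases "1 \<in> K")
    case True
    then show ?thesis
      using right_ideal_eq_UNIV_iff[OF K(1)] by simp
  next
    case False
    then have "K \<in> ?P"
      using K M(3) by simp
    then show ?thesis
      using max K(2) by simp
  qed
  then have "maximal_right_ideal M"
    unfolding maximal_right_ideal_def using M by blast
  with M show ?thesis by blast
qed

lemma local_ring_maximal_unique:
  assumes "local_ring TYPE('a::ring_1)" "maximal_right_ideal (M :: 'a set)"
  shows "jacobson_radical = M"
proof -
  have "{M :: 'a set. maximal_right_ideal M} = {M}"
    using assms unfolding local_ring_def by blast
  then show ?thesis unfolding jacobson_radical_def by simp
qed

text \<open>Otherwise \<open>u R\<close> would lie in a maximal right ideal, and the only one is the radical.\<close>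

lemma right_invertible_outside_radical:
  fixes u :: "'a::ring_1"
  assumes loc: "local_ring TYPE('a)" and u: "u \<notin> jacobson_radical"
  shows "\<exists>v. u * v = 1"
proof (rule ccontr)
  assume "\<not> ?thesis"
  then have "1 \<notin> principal_right_ideal u"
    unfolding principal_right_ideal_def by auto
  then obtain M where M: "maximal_right_ideal M" "principal_right_ideal u \<subseteq> M"
    using right_ideal_subset_maximal[OF right_ideal_principal] by blast
  have "u \<in> principal_right_ideal u"
    unfolding principal_right_ideal_def by (metis (mono_tags) mem_Collect_eq mult.right_neutral)
  with M local_ring_maximal_unique[OF loc] u show False by blast
qed

text \<open>Thus \<open>g\<^sup>n R\<close> lies in the \<open>n\<close>-th power of the radical \<open>g R\<close>, which carries the vanishing of the
  intersection of these powers over to the right ideals \<open>g\<^sup>n R\<close>.\<close>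

lemma power_mult_mem_ideal_power:
  fixes g :: "'a::ring_1"
  assumes "right_ideal J" "g \<in> J"
  shows "g ^ n * r \<in> ideal_power J n"
proof (induction n arbitrary: r)
  case (Suc n)
  have "g ^ n \<in> ideal_power J n"
    using Suc.IH[of 1] by simp
  moreover have "g * r \<in> J"
    using assms unfolding right_ideal_def by blast
  ultimately have "\<exists>m a b. g ^ Suc n * r = (\<Sum>k<m. a k * b k) \<and>
      (\<forall>k<m. a k \<in> ideal_power J n) \<and> (\<forall>k<(m::nat). b k \<in> J)"
    by (intro exI[of _ "1::nat"] exI[of _ "\<lambda>_. g ^ n"] exI[of _ "\<lambda>_. g * r"])
      (simp add: mult.assoc power_Suc2 del: power_Suc)
  then show ?case
    by (simp add: ideal_prod_def)
qed simp

text \<open>The exponent is one less than the first \<open>n\<close> with \<open>x \<notin> g\<^sup>n R\<close>. The cofactor lies outside the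
  radical \<open>g R\<close>, since otherwise another factor \<open>g\<close> could be split off.\<close>

lemma power_mult_right_invertible:
  fixes g x :: "'a::ring_1"
  assumes loc: "local_ring TYPE('a)"
    and J: "(jacobson_radical :: 'a set) = principal_right_ideal g"
    and Int: "(\<Inter>n. ideal_power (jacobson_radical :: 'a set) n) = {0}"
    and x: "x \<noteq> 0"
  shows "\<exists>n u v. x = g ^ n * u \<and> u * v = 1"
proof -
  have g: "g \<in> jacobson_radical"
    unfolding J principal_right_ideal_def by (metis (mono_tags) mem_Collect_eq mult.right_neutral)
  have "right_ideal (jacobson_radical :: 'a set)"
    unfolding J by (rule right_ideal_principal)
  then have pow: "g ^ n * r \<in> ideal_power jacobson_radical n" for n r
    using g by (rule power_mult_mem_ideal_power)
  have ex: "\<exists>n. \<nexists>r. x = g ^ n * r"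
  proof (rule ccontr)
    assume "\<not> ?thesis"
    then have "x \<in> ideal_power jacobson_radical n" for n
      using pow by metis
    then have "x \<in> (\<Inter>n. ideal_power jacobson_radical n)"
      by simp
    with x show False
      unfolding Int by simp
  qed
  define N where "N = (LEAST n. \<nexists>r. x = g ^ n * r)"
  have N: "\<nexists>r. x = g ^ N * r"
    unfolding N_def using ex by (rule LeastI_ex)
  then have "N \<noteq> 0"
    by (metis mult_1 power_0)
  then obtain n where n: "N = Suc n"
    using not0_implies_Suc by blast
  then obtain u where u: "x = g ^ n * u"
    using not_less_Least[of n "\<lambda>n. \<nexists>r. x = g ^ n * r"] unfolding N_def by auto
  have "u \<notin> jacobson_radical"
  proof
    assume "u \<in> jacobson_radical"
    then obtain r where "u = g * r"
      unfolding J principal_right_ideal_def by blast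
    then have "x = g ^ N * r"
      by (simp add: u n mult.assoc power_Suc2 del: power_Suc)
    with N show False by blast
  qed
  with u show ?thesis
    using right_invertible_outside_radical[OF loc] by blast
qed

text \<open>The element with the smaller exponent divides the other one on the left, because its
  cofactor can be cancelled by a right inverse.\<close>

lemma right_chain_local_domain:
  fixes g x y :: "'a::ring_1"
  assumes loc: "local_ring TYPE('a)"
    and J: "(jacobson_radical :: 'a set) = principal_right_ideal g"
    and Int: "(\<Inter>n. ideal_power (jacobson_radical :: 'a set) n) = {0}"
  shows "(\<exists>c. y = x * c) \<or> (\<exists>c. x = y * c)"
proof (cases "x = 0 \<or> y = 0")
  case True
  then have "y = x * 0 \<or> x = y * 0"
    by auto
  then show ?thesis by blast
next
  case False
  note decomp = power_mult_right_invertible[OF loc J Int]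
  have div: "\<exists>c. g ^ m * u' = g ^ n * u * c" if "u * v = 1" "n \<le> m" for n m u v u'
  proof
    have "g ^ m * u' = g ^ n * ((u * v) * (g ^ (m - n) * u'))"
      using that by (simp add: mult.assoc[symmetric] power_add[symmetric])
    then show "g ^ m * u' = g ^ n * u * (v * (g ^ (m - n) * u'))"
      by (simp add: mult.assoc)
  qed
  obtain n u v where x: "x = g ^ n * u" "u * v = 1"
    using decomp False by blast
  obtain m u' v' where y: "y = g ^ m * u'" "u' * v' = 1"
    using decomp False by blast
  show ?thesis
    unfolding x(1) y(1) using div[OF x(2)] div[OF y(2)] by (meson nat_le_linear)
qed

section \<open>Singular matrices of size two\<close>

lemma vec2_scalar_factor:
  fixes v :: "'a::ring_1 ^ 2"
  assumes chain: "\<And>x y :: 'a. (\<exists>c. y = x * c) \<or> (\<exists>c. x = y * c)"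
  shows "\<exists>a q l. v = (\<chi> j. a * q $ j) \<and> q $ l = 1"
  using chain[of "v $ 2" "v $ 1"]
proof
  assume "\<exists>c. v $ 2 = v $ 1 * c"
  then obtain c where "v $ 2 = v $ 1 * c" by blast
  then have "v = (\<chi> j. v $ 1 * vector [1, c] $ j) \<and> vector [1, c] $ (1::2) = (1::'a)"
    by (simp add: vec_eq_iff forall_2)
  then show ?thesis by blast
next
  assume "\<exists>c. v $ 1 = v $ 2 * c"
  then obtain c where "v $ 1 = v $ 2 * c" by blast
  then have "v = (\<chi> j. v $ 2 * vector [c, 1] $ j) \<and> vector [c, 1] $ (2::2) = (1::'a)"
    by (simp add: vec_eq_iff forall_2)
  then show ?thesis by blast
qed

text \<open>An entry \<open>1\<close> at index \<open>l\<close> of an annihilating row expresses row \<open>l\<close> of \<open>A\<close> as a left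
  multiple of the other row, indexed \<open>k\<close>.\<close>

lemma outer_row_of_left_annihilated:
  fixes A :: "'a::ring_1 ^ 2 ^ 2"
  assumes ann: "\<And>j. (\<Sum>i\<in>UNIV. w $ i * A $ i $ j) = 0" and w: "w $ l = 1"
  shows "\<exists>p k. p $ k = 1 \<and> A = outer p (A $ k)"
proof -
  have rows: "w $ 1 * A $ 1 $ j + w $ 2 * A $ 2 $ j = 0" for j
    using ann[of j] by (simp add: sum_2)
  consider "l = 1" | "l = 2"
    using exhaust_2 by blast
  then show ?thesis
  proof cases
    case 1
    then have "A $ 1 $ j = - (w $ 2) * A $ 2 $ j" for j
      using rows[of j] w by (simp add: eq_neg_iff_add_eq_0)
    then have "A = outer (vector [- (w $ 2), 1]) (A $ 2)"
      by (simp add: outer_def vec_eq_iff forall_2)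
    then show ?thesis by (intro exI[of _ "vector [- (w $ 2), 1]"] exI[of _ 2]) simp
  next
    case 2
    then have "A $ 2 $ j = - (w $ 1) * A $ 1 $ j" for j
      using rows[of j] w by (simp add: eq_neg_iff_add_eq_0 add.commute)
    then have "A = outer (vector [1, - (w $ 1)]) (A $ 1)"
      by (simp add: outer_def vec_eq_iff forall_2)
    then show ?thesis by (intro exI[of _ "vector [1, - (w $ 1)]"] exI[of _ 1]) simp
  qed
qed

theorem theorem10:
  fixes g :: "'a::ring_1_no_zero_divisors"
    and A :: "'a ^ 2 ^ 2"
  assumes "local_ring TYPE('a)"
    and "(jacobson_radical :: 'a set) = principal_right_ideal g"
    and "(\<Inter>n. ideal_power (jacobson_radical :: 'a set) n) = {0}"
    and "left_ann A \<noteq> {0}"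
  shows "product_of_idempotents A"
proof -
  note factor = vec2_scalar_factor[OF right_chain_local_domain[OF assms(1-3)]]
  have "0 \<in> left_ann A"
    by (simp add: left_ann_def matrix_matrix_mult_def vec_eq_iff)
  with assms(4) obtain X where "X \<in> left_ann A" and "X \<noteq> 0"
    by auto
  then have X: "X ** A = 0" "X \<noteq> 0"
    by (simp_all add: left_ann_def)
  from X(2) obtain i where i: "X $ i \<noteq> 0"
    by (auto simp: vec_eq_iff)
  obtain x w l where v: "X $ i = (\<chi> j. x * w $ j)" and w: "w $ l = 1"
    using factor by blast
  have "x \<noteq> 0"
    using i v by (auto simp: vec_eq_iff)
  have ann: "(\<Sum>k\<in>UNIV. w $ k * A $ k $ j) = 0" for j
  proof -
    have "x * (\<Sum>k\<in>UNIV. w $ k * A $ k $ j) = (X ** A) $ i $ j"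
      by (simp add: matrix_matrix_mult_def v sum_distrib_left mult.assoc)
    then show ?thesis
      using X(1) \<open>x \<noteq> 0\<close> by simp
  qed
  obtain p k where p: "p $ k = 1" and A: "A = outer p (A $ k)"
    using outer_row_of_left_annihilated[OF ann w] by blast
  obtain a q l' where r: "A $ k = (\<chi> j. a * q $ j)" and q: "q $ l' = 1"
    using factor by blast
  have "(1::2) \<noteq> k \<or> (2::2) \<noteq> k"
    by auto
  then obtain k' where "k' \<noteq> k"
    by blast
  then have "product_of_idempotents (outer p (\<chi> j. a * q $ j))"
    by (rule product_of_idempotents_outer[OF p q])
  then show ?thesis
    using A r by simp
qed

end
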